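(* Let $A$ be a subset of $\omega^{\subseteq\omega}$. The following are equivalent: (1) $\Delta(A)$ holds; (2) $\nabla^*(A)$ is halvable in $\nabla$; (3) $\nabla^+(A)$ is monotonically normal in $\nabla$.
   Context: Nabla product: $\square(\omega+1)^\omega$ is the set $(\omega+1)^\omega$ with base all boxes $\prod_n U_n$, $U_n$ open in $\omega+1$ (order topology); $x\sim y$ iff $\{n:x(n)\ne y(n)\}$ is finite; $\nabla=\nabla(\omega+1)^\omega$ is the quotient space $\square(\omega+1)^\omega/\sim$. Partial functions: $\omega^{\subseteq\omega}$ is the set of all functions $x:N\to\omega$ with $N\subseteq\omega$ ($\operatorname{dom}x=N$), including the empty function, each identified with its graph; $\omega^{\subset\omega}$ is the set of those with infinite and co-infinite domain. $x=^*y$ means $x\setminus y$ and $y\setminus x$ are finite; for $B\subseteq\omega^{\subseteq\omega}$, $B^*=\{y\in\omega^{\subseteq\omega}: y=^*x\text{ for some }x\in B\}$. For $h\in\omega^\omega$, $x>^*h$ means $x(n)>h(n)$ for all but finitely many $n\in\operatorname{dom}x$. $x,y$ switch if $x\setminus y$ and $y\setminus x$ are infinite and $x(n)=y(n)$ for all but finitely many $n\in\operatorname{dom}x\cap\operatorname{dom}y$. $\Delta(A)$ is the statement: there exists $F:A\to\omega^\omega$ such that if $x,y\in A$ switch, then $x\setminus y\not>^*F(y)$ or $y\setminus x\not>^*F(x)$. Identification: for $x\in\omega^{\subseteq\omega}$ let $x'\in(\omega+1)^\omega$ extend $x$ with value $\omega$ outside $\operatorname{dom}x$, and let $\overline{x}=[x']_\sim\in\nabla$.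 For $B\subseteq\omega^{\subseteq\omega}$ put $\nabla(B)=\{\overline{x}:x\in B\}$ (a subspace of $\nabla$), $\nabla^*(A)=\nabla(A\cap\omega^{\subset\omega})$ and $\nabla^+(A)=\nabla((A\cup\omega^\omega\cup\{\emptyset\})^* )$. For a subspace $Y$ of a space $X$: $Y$ is monotonically normal in $X$ if to every $x\in Y$ and every open $U$ of $X$ containing $x$ there is assigned an open set $G(x,U)$ of $X$ with $x\in G(x,U)\subseteq U$, such that $G(x,U)\cap G(y,V)\ne\emptyset$ implies $x\in V$ or $y\in U$. A neighbornet for $Y$ in $X$ is a function assigning to each $x\in Y$ a neighborhood of $x$ in $X$. $Y$ is halvable in $X$ if for every neighbornet $T$ for $Y$ in $X$ there is a neighbornet $S$ for $Y$ in $X$ such that $S(x)\cap S(y)\neq\emptyset$ implies $x\in T(y)$ or $y\in T(x)$, for all $x,y\in Y$. *)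

theory Defs
  imports "HOL-Analysis.Analysis"
begin

section \<open>The nabla product\<close>

text \<open>
  The ordinal space \<open>\<omega> + 1\<close> is the type \<^typ>\<open>enat\<close>, whose \<^const>\<open>open\<close> is the order topology and
  whose point \<open>\<omega>\<close> is \<open>\<infinity>\<close>.
\<close>

definition is_box :: "(nat \<Rightarrow> enat) set \<Rightarrow> bool" where
  "is_box B \<longleftrightarrow> (\<exists>U. (\<forall>n. open (U n)) \<and> B = {x. \<forall>n. x n \<in> U n})"

definition box_topology :: "(nat \<Rightarrow> enat) topology" where
  "box_topology = topology (arbitrary union_of is_box)"

definition mod_fin :: "((nat \<Rightarrow> enat) \<times> (nat \<Rightarrow> enat)) set" where
  "mod_fin = {(x, y). finite {n. x n \<noteq> y n}}"

text \<open>
  The quotient topology: since a point of the quotient is an equivalence class, the preimage of a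
  set \<open>V\<close> of points under the quotient map is \<open>\<Union>V\<close>.
\<close>

definition nabla :: "(nat \<Rightarrow> enat) set topology" where
  "nabla = topology (\<lambda>V. V \<subseteq> UNIV // mod_fin \<and> openin box_topology (\<Union>V))"

lemma openin_box_topology: "openin box_topology = arbitrary union_of is_box"
proof -
  have "is_box (S \<inter> T)" if ST: "is_box S" "is_box T" for S T
  proof -
    obtain U V where U: "\<And>n. open (U n)" "S = {x. \<forall>n. x n \<in> U n}"
      and V: "\<And>n. open (V n)" "T = {x. \<forall>n. x n \<in> V n}"
      using ST unfolding is_box_def by blast
    have "\<forall>n. open (U n \<inter> V n)" "S \<inter> T = {x. \<forall>n. x n \<in> U n \<inter> V n}"
      using U V by auto
    then show ?thesis
      unfolding is_box_def by (intro exI[of _ "\<lambda>n. U n \<inter> V n"]) simp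
  qed
  then show ?thesis
    unfolding box_topology_def by (intro topology_inverse' istopology_base)
qed

lemma topspace_box_topology [simp]: "topspace box_topology = UNIV"
proof -
  have "is_box UNIV"
    unfolding is_box_def by (intro exI[of _ "\<lambda>_. UNIV"]) simp
  then have "openin box_topology UNIV"
    by (simp add: openin_box_topology arbitrary_union_of_inc)
  then show ?thesis
    using openin_subset by fastforce
qed

lemma equiv_mod_fin: "equiv UNIV mod_fin"
proof (rule equivI)
  show "mod_fin \<subseteq> UNIV \<times> UNIV"
    by simp
  show "refl mod_fin"
    by (simp add: refl_on_def mod_fin_def)
  show "sym mod_fin"
    by (auto simp: sym_def mod_fin_def eq_commute)
  show "trans mod_fin"
  proof (rule transI)
    fix x y z assume "(x, y) \<in> mod_fin" "(y, z) \<in> mod_fin"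
    then have "finite ({n. x n \<noteq> y n} \<union> {n. y n \<noteq> z n})"
      by (simp add: mod_fin_def)
    moreover have "{n. x n \<noteq> z n} \<subseteq> {n. x n \<noteq> y n} \<union> {n. y n \<noteq> z n}"
      by auto
    ultimately show "(x, z) \<in> mod_fin"
      by (auto simp: mod_fin_def intro: finite_subset)
  qed
qed

lemma openin_nabla:
  "openin nabla V \<longleftrightarrow> V \<subseteq> UNIV // mod_fin \<and> openin box_topology (\<Union>V)"
proof -
  have "istopology (\<lambda>V. V \<subseteq> UNIV // mod_fin \<and> openin box_topology (\<Union>V))"
    unfolding istopology_def
  proof (intro conjI allI impI)
    fix S T
    assume S: "S \<subseteq> UNIV // mod_fin \<and> openin box_topology (\<Union>S)"
      and T: "T \<subseteq> UNIV // mod_fin \<and> openin box_topology (\<Union>T)"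
    show "S \<inter> T \<subseteq> UNIV // mod_fin"
      using S by blast
    have "a = b" if "a \<in> S" "b \<in> T" "x \<in> a" "x \<in> b" for a b x
    proof -
      have "a \<in> UNIV // mod_fin" "b \<in> UNIV // mod_fin"
        using that S T by blast+
      then show ?thesis
        using quotient_disj[OF equiv_mod_fin, of a b] that by blast
    qed
    then have "\<Union>(S \<inter> T) = \<Union>S \<inter> \<Union>T"
      by blast
    then show "openin box_topology (\<Union>(S \<inter> T))"
      using S T by auto
  next
    fix K
    assume K: "\<forall>V\<in>K. V \<subseteq> UNIV // mod_fin \<and> openin box_topology (\<Union>V)"
    then show "\<Union>K \<subseteq> UNIV // mod_fin"
      by blast
    have "\<Union>(\<Union>K) = \<Union>(Union ` K)"
      by blast
    moreover have "openin box_topology (\<Union>(Union ` K))"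
      using K by (intro openin_Union) auto
    ultimately show "openin box_topology (\<Union>(\<Union>K))"
      by simp
  qed
  then show ?thesis
    by (simp add: nabla_def topology_inverse')
qed

lemma topspace_nabla: "topspace nabla = UNIV // mod_fin"
proof -
  have "openin nabla (UNIV // mod_fin)"
    using openin_topspace[of box_topology]
    by (simp add: openin_nabla Union_quotient[OF equiv_mod_fin])
  then show ?thesis
    using openin_nabla openin_subset by (metis openin_topspace subset_antisym)
qed

lemma quotient_map_nabla: "quotient_map box_topology nabla (\<lambda>x. mod_fin `` {x})"
proof -
  have "{x. mod_fin `` {x} \<in> V} = \<Union>V" if V: "V \<subseteq> UNIV // mod_fin" for V
  proof (intro set_eqI iffI)
    fix x assume "x \<in> {x. mod_fin `` {x} \<in> V}"
    then show "x \<in> \<Union>V"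
      using equiv_class_self[OF equiv_mod_fin, of x] by blast
  next
    fix x assume "x \<in> \<Union>V"
    then obtain a where a: "a \<in> V" "x \<in> a"
      by blast
    then have "a \<in> UNIV // mod_fin"
      using V by blast
    then obtain y where "a = mod_fin `` {y}"
      by (rule quotientE)
    then have "a = mod_fin `` {x}"
      using a equiv_class_eq[OF equiv_mod_fin, of y x] by auto
    then show "x \<in> {x. mod_fin `` {x} \<in> V}"
      using a by auto
  qed
  moreover have "range (\<lambda>x. mod_fin `` {x}) = UNIV // mod_fin"
    by (auto simp: quotient_def)
  ultimately show ?thesis
    by (auto simp: quotient_map_def topspace_nabla openin_nabla)
qed


section \<open>Partial functions\<close>

text \<open>
  A partial function from \<open>\<omega>\<close> to \<open>\<omega>\<close> is a map \<^typ>\<open>nat \<rightharpoonup> nat\<close>; differences such as \<open>x - y\<close> are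
  differences of graphs.
\<close>

definition pdiff :: "(nat \<rightharpoonup> nat) \<Rightarrow> (nat \<rightharpoonup> nat) \<Rightarrow> (nat \<rightharpoonup> nat)" where
  "pdiff x y = x |` {n. x n \<noteq> y n}"

lemma graph_pdiff: "Map.graph (pdiff x y) = Map.graph x - Map.graph y"
  by (auto simp: Map.graph_def pdiff_def restrict_map_def split: if_splits)

definition almost_eq :: "(nat \<rightharpoonup> nat) \<Rightarrow> (nat \<rightharpoonup> nat) \<Rightarrow> bool" where
  "almost_eq x y \<longleftrightarrow>
     finite (Map.graph x - Map.graph y) \<and> finite (Map.graph y - Map.graph x)"

definition almost_closure :: "(nat \<rightharpoonup> nat) set \<Rightarrow> (nat \<rightharpoonup> nat) set" where
  "almost_closure B = {y. \<exists>x\<in>B. almost_eq y x}"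

definition almost_gt :: "(nat \<rightharpoonup> nat) \<Rightarrow> (nat \<Rightarrow> nat) \<Rightarrow> bool" where
  "almost_gt x h \<longleftrightarrow> finite {n \<in> dom x. \<not> the (x n) > h n}"

definition switch :: "(nat \<rightharpoonup> nat) \<Rightarrow> (nat \<rightharpoonup> nat) \<Rightarrow> bool" where
  "switch x y \<longleftrightarrow>
     infinite (Map.graph x - Map.graph y) \<and> infinite (Map.graph y - Map.graph x) \<and>
     finite {n \<in> dom x \<inter> dom y. x n \<noteq> y n}"

definition Delta :: "(nat \<rightharpoonup> nat) set \<Rightarrow> bool" where
  "Delta A \<longleftrightarrow>
     (\<exists>F :: (nat \<rightharpoonup> nat) \<Rightarrow> (nat \<Rightarrow> nat).
        \<forall>x\<in>A. \<forall>y\<in>A. switch x y \<longrightarrow>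
          \<not> almost_gt (pdiff x y) (F y) \<or> \<not> almost_gt (pdiff y x) (F x))"

definition total_funs :: "(nat \<rightharpoonup> nat) set" where
  "total_funs = {x. dom x = UNIV}"

definition inf_coinf :: "(nat \<rightharpoonup> nat) set" where
  "inf_coinf = {x. infinite (dom x) \<and> infinite (- dom x)}"


section \<open>Partial functions as points of the nabla product\<close>

definition extend :: "(nat \<rightharpoonup> nat) \<Rightarrow> (nat \<Rightarrow> enat)" where
  "extend x = (\<lambda>n. case x n of None \<Rightarrow> \<infinity> | Some k \<Rightarrow> enat k)"

definition nabla_point :: "(nat \<rightharpoonup> nat) \<Rightarrow> (nat \<Rightarrow> enat) set" where
  "nabla_point x = mod_fin `` {extend x}"

definition nabla_set :: "(nat \<rightharpoonup> nat) set \<Rightarrow> (nat \<Rightarrow> enat) set set" where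
  "nabla_set B = nabla_point ` B"

definition nabla_star :: "(nat \<rightharpoonup> nat) set \<Rightarrow> (nat \<Rightarrow> enat) set set" where
  "nabla_star A = nabla_set (A \<inter> inf_coinf)"

definition nabla_plus :: "(nat \<rightharpoonup> nat) set \<Rightarrow> (nat \<Rightarrow> enat) set set" where
  "nabla_plus A = nabla_set (almost_closure (A \<union> total_funs \<union> {Map.empty}))"

lemma nabla_set_subset: "nabla_set B \<subseteq> topspace nabla"
  by (auto simp: nabla_set_def nabla_point_def topspace_nabla quotient_def)


section \<open>Relative monotone normality and halvability\<close>

definition monotonically_normal_in :: "'a topology \<Rightarrow> 'a set \<Rightarrow> bool" where
  "monotonically_normal_in X Y \<longleftrightarrow>
     Y \<subseteq> topspace X \<and>
     (\<exists>G :: 'a \<Rightarrow> 'a set \<Rightarrow> 'a set.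
        (\<forall>x\<in>Y. \<forall>U. openin X U \<and> x \<in> U \<longrightarrow>
           openin X (G x U) \<and> x \<in> G x U \<and> G x U \<subseteq> U) \<and>
        (\<forall>x\<in>Y. \<forall>y\<in>Y. \<forall>U V. openin X U \<and> x \<in> U \<and> openin X V \<and> y \<in> V \<and>
           G x U \<inter> G y V \<noteq> {} \<longrightarrow> x \<in> V \<or> y \<in> U))"

text \<open>Neighborhoods need not be open.\<close>

definition neighborhood_in :: "'a topology \<Rightarrow> 'a \<Rightarrow> 'a set \<Rightarrow> bool" where
  "neighborhood_in X x N \<longleftrightarrow> N \<subseteq> topspace X \<and> (\<exists>U. openin X U \<and> x \<in> U \<and> U \<subseteq> N)"

definition neighbornet_in :: "'a topology \<Rightarrow> 'a set \<Rightarrow> ('a \<Rightarrow> 'a set) \<Rightarrow> bool" where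
  "neighbornet_in X Y T \<longleftrightarrow> (\<forall>x\<in>Y. neighborhood_in X x (T x))"

definition halvable_in :: "'a topology \<Rightarrow> 'a set \<Rightarrow> bool" where
  "halvable_in X Y \<longleftrightarrow>
     Y \<subseteq> topspace X \<and>
     (\<forall>T. neighbornet_in X Y T \<longrightarrow>
        (\<exists>S. neighbornet_in X Y S \<and>
           (\<forall>x\<in>Y. \<forall>y\<in>Y. S x \<inter> S y \<noteq> {} \<longrightarrow> x \<in> T y \<or> y \<in> T x)))"

end

theory Submission
  imports Defs
begin

text \<open>
  A basic neighborhood \<open>N(x, h)\<close> of \<open>x\<close> consists of the classes of those \<open>z\<close> that extend \<open>x\<close> and
  exceed \<open>h\<close> off \<open>dom x\<close>, up to finitely many coordinates. Hence \<open>N(x, g)\<close> meets \<open>N(y, h)\<close> iff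
  \<open>x\<close> and \<open>y\<close> almost agree on their common domain, \<open>x - y\<close> is almost above \<open>h\<close> and \<open>y - x\<close> is
  almost above \<open>g\<close>. If \<open>F\<close> witnesses \<open>\<Delta>(A)\<close>, shrinking every \<open>N(x, h)\<close> to \<open>N(x, max h (F x))\<close>
  separates all switching pairs, while a compatible pair that does not switch is almost nested,
  and then the larger function lies in the given neighborhood of the smaller one. Total functions
  and the empty function never switch with anything, so they come for free. Conversely, members of a
  switching pair lie in no basic neighborhood of each other, so halving any neighbornet of basic
  sets produces \<open>F\<close>.
\<close>

section \<open>Differences and switching in terms of cofinitely many coordinates\<close>

lemma finite_graph_diff_iff:
  fixes x y :: "nat \<rightharpoonup> nat"
  shows "finite (Map.graph x - Map.graph y) \<longleftrightarrow> (\<forall>\<^sub>\<infinity>n. n \<in> dom x \<longrightarrow> x n = y n)"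
proof -
  have "dom (pdiff x y) = {n. \<not> (n \<in> dom x \<longrightarrow> x n = y n)}"
    by (auto simp: pdiff_def)
  then show ?thesis
    by (metis graph_pdiff finite_graph_iff_finite_dom eventually_cofinite)
qed

lemma almost_gt_pdiff_iff:
  "almost_gt (pdiff x y) h \<longleftrightarrow> (\<forall>\<^sub>\<infinity>n. n \<in> dom x \<and> x n \<noteq> y n \<longrightarrow> h n < the (x n))"
proof -
  have "{n \<in> dom (pdiff x y). \<not> the (pdiff x y n) > h n}
      = {n. \<not> (n \<in> dom x \<and> x n \<noteq> y n \<longrightarrow> h n < the (x n))}"
    by (auto simp: pdiff_def restrict_map_def split: if_splits)
  then show ?thesis
    by (simp add: almost_gt_def eventually_cofinite)
qed

lemma switch_iff:
  "switch x y \<longleftrightarrow> \<not> (\<forall>\<^sub>\<infinity>n. n \<in> dom x \<longrightarrow> x n = y n) \<and> \<not> (\<forall>\<^sub>\<infinity>n. n \<in> dom y \<longrightarrow> y n = x n)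
     \<and> (\<forall>\<^sub>\<infinity>n. n \<in> dom x \<and> n \<in> dom y \<longrightarrow> x n = y n)"
proof -
  have "{n \<in> dom x \<inter> dom y. x n \<noteq> y n} = {n. \<not> (n \<in> dom x \<and> n \<in> dom y \<longrightarrow> x n = y n)}"
    by auto
  then show ?thesis
    unfolding switch_def finite_graph_diff_iff by (simp add: eventually_cofinite)
qed

lemma switch_sym: "switch x y \<Longrightarrow> switch y x"
  by (auto simp: switch_iff elim!: eventually_mono)

text \<open>If \<open>dom x\<close> is finite, so is x - y; if it is cofinite, agreement on the
  common domain leaves y - x finite. Hence \<Delta>(A) constrains only members of A in
  \<open>inf_coinf\<close>, and \<open>nabla_star A\<close> carries enough information to recover
  it.\<close>

lemma switch_inf_coinf:
  assumes "switch x y"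
  shows "x \<in> inf_coinf"
proof -
  have "infinite (dom x)"
  proof
    assume "finite (dom x)"
    then have "\<forall>\<^sub>\<infinity>n. n \<notin> dom x"
      by (simp add: eventually_cofinite)
    then have "\<forall>\<^sub>\<infinity>n. n \<in> dom x \<longrightarrow> x n = y n"
      by (rule eventually_mono) blast
    then show False
      using assms by (simp add: switch_iff)
  qed
  moreover have "infinite (- dom x)"
  proof
    assume "finite (- dom x)"
    then have "\<forall>\<^sub>\<infinity>n. n \<in> dom x"
      by (simp add: eventually_cofinite Compl_eq)
    moreover have "\<forall>\<^sub>\<infinity>n. n \<in> dom x \<and> n \<in> dom y \<longrightarrow> x n = y n"
      using assms by (simp add: switch_iff)
    ultimately have "\<forall>\<^sub>\<infinity>n. n \<in> dom y \<longrightarrow> y n = x n"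
      by eventually_elim auto
    then show False
      using assms by (simp add: switch_iff)
  qed
  ultimately show ?thesis
    by (simp add: inf_coinf_def)
qed

section \<open>Basic neighborhoods in the nabla product\<close>

definition slot :: "(nat \<rightharpoonup> nat) \<Rightarrow> (nat \<Rightarrow> nat) \<Rightarrow> nat \<Rightarrow> enat set" where
  "slot x h n = (case x n of None \<Rightarrow> {enat (h n)<..} | Some k \<Rightarrow> {enat k})"

text \<open>Asking for membership at almost all coordinates makes the set of representatives
  saturated under \<open>mod_fin\<close>, so whether a class belongs can be tested on any
  representative.\<close>

definition basic_nbhd :: "(nat \<rightharpoonup> nat) \<Rightarrow> (nat \<Rightarrow> nat) \<Rightarrow> (nat \<Rightarrow> enat) set set" where
  "basic_nbhd x h = (\<lambda>z. mod_fin `` {z}) ` {z. \<forall>\<^sub>\<infinity>n. z n \<in> slot x h n}"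

lemma open_slot: "open (slot x h n)"
  by (auto simp: slot_def open_enat split: option.split)

lemma extend_in_slot_self: "extend x n \<in> slot x h n"
  by (auto simp: slot_def extend_def split: option.split)

lemma mod_fin_iff: "(z, w) \<in> mod_fin \<longleftrightarrow> (\<forall>\<^sub>\<infinity>n. z n = w n)"
  by (simp add: mod_fin_def eventually_cofinite)

lemma mod_fin_class_eq_iff: "mod_fin `` {z} = mod_fin `` {w} \<longleftrightarrow> (\<forall>\<^sub>\<infinity>n. z n = w n)"
  using eq_equiv_class_iff[OF equiv_mod_fin, of z w] by (simp add: mod_fin_iff)

lemma class_in_basic_nbhd_iff:
  "mod_fin `` {z} \<in> basic_nbhd x h \<longleftrightarrow> (\<forall>\<^sub>\<infinity>n. z n \<in> slot x h n)"
proof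
  assume "mod_fin `` {z} \<in> basic_nbhd x h"
  then obtain w where "\<forall>\<^sub>\<infinity>n. z n = w n" "\<forall>\<^sub>\<infinity>n. w n \<in> slot x h n"
    by (auto simp: basic_nbhd_def mod_fin_class_eq_iff)
  then show "\<forall>\<^sub>\<infinity>n. z n \<in> slot x h n"
    by eventually_elim simp
qed (auto simp: basic_nbhd_def)

lemma nabla_point_in_basic_nbhd_self: "nabla_point x \<in> basic_nbhd x h"
  by (simp add: nabla_point_def class_in_basic_nbhd_iff extend_in_slot_self)

lemma nabla_point_in_basic_nbhd_iff:
  "nabla_point y \<in> basic_nbhd x h \<longleftrightarrow>
     (\<forall>\<^sub>\<infinity>n. n \<in> dom x \<longrightarrow> x n = y n) \<and> almost_gt (pdiff y x) h"
proof -
  have "extend y n \<in> slot x h n \<longleftrightarrow>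
      (n \<in> dom x \<longrightarrow> x n = y n) \<and> (n \<in> dom y \<and> y n \<noteq> x n \<longrightarrow> h n < the (y n))" for n
    by (auto simp: slot_def extend_def split: option.split)
  then show ?thesis
    by (simp add: nabla_point_def class_in_basic_nbhd_iff almost_gt_pdiff_iff eventually_conj_iff)
qed

lemma mem_Union_nabla_open_iff:
  assumes "U \<subseteq> UNIV // mod_fin"
  shows "z \<in> \<Union>U \<longleftrightarrow> mod_fin `` {z} \<in> U"
proof
  assume "z \<in> \<Union>U"
  then obtain a where a: "a \<in> U" "z \<in> a"
    by blast
  then obtain w where "a = mod_fin `` {w}"
    using assms by (blast elim: quotientE)
  then have "a = mod_fin `` {z}"
    using a equiv_class_eq[OF equiv_mod_fin, of w z] by auto
  then show "mod_fin `` {z} \<in> U"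
    using a by simp
next
  assume "mod_fin `` {z} \<in> U"
  then show "z \<in> \<Union>U"
    using equiv_class_self[OF equiv_mod_fin, of z] by blast
qed

lemma openin_basic_nbhd: "openin nabla (basic_nbhd x h)"
proof -
  have sub: "basic_nbhd x h \<subseteq> UNIV // mod_fin"
    by (auto simp: basic_nbhd_def quotient_def)
  have eq: "\<Union>(basic_nbhd x h) = {z. \<forall>\<^sub>\<infinity>n. z n \<in> slot x h n}"
    using mem_Union_nabla_open_iff[OF sub] class_in_basic_nbhd_iff by blast
  have "openin box_topology {z. \<forall>\<^sub>\<infinity>n. z n \<in> slot x h n}"
  proof (subst openin_subopen, safe)
    fix z :: "nat \<Rightarrow> enat"
    assume z: "\<forall>\<^sub>\<infinity>n. z n \<in> slot x h n"
    \<comment> \<open>The finitely many coordinates at which z misses its slot are left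
      unrestricted, so members of the box still meet almost every slot.\<close>
    define B where "B = {w. \<forall>n. w n \<in> (if z n \<in> slot x h n then slot x h n else UNIV)}"
    have "is_box B"
      unfolding is_box_def B_def
      by (intro exI[of _ "\<lambda>n. if z n \<in> slot x h n then slot x h n else UNIV"])
         (simp add: open_slot)
    then have "openin box_topology B"
      by (simp add: openin_box_topology arbitrary_union_of_inc)
    moreover have "z \<in> B"
      by (simp add: B_def)
    moreover have "B \<subseteq> {z. \<forall>\<^sub>\<infinity>n. z n \<in> slot x h n}"
    proof safe
      fix w assume w: "w \<in> B"
      show "\<forall>\<^sub>\<infinity>n. w n \<in> slot x h n"
        using z
      proof (rule eventually_mono)
        fix n assume "z n \<in> slot x h n"
        then show "w n \<in> slot x h n"
          using w unfolding B_def by (metis (mono_tags, lifting) mem_Collect_eq)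
      qed
    qed
    ultimately show "\<exists>T. openin box_topology T \<and> z \<in> T \<and> T \<subseteq> {z. \<forall>\<^sub>\<infinity>n. z n \<in> slot x h n}"
      by blast
  qed
  then show ?thesis
    using sub eq by (simp add: openin_nabla)
qed

text \<open>The slot at n depends on h only through \<open>h n\<close>. Quantifying over all h with
  that value lets the bounds k chosen at separate coordinates be glued into one function.\<close>

lemma slot_subset_open:
  assumes "open V" "extend x n \<in> V"
  shows "\<exists>k. \<forall>h. h n = k \<longrightarrow> slot x h n \<subseteq> V"
proof (cases "x n")
  case None
  then have "\<infinity> \<in> V"
    using assms by (simp add: extend_def)
  then obtain k where "{enat k<..} \<subseteq> V"
    using assms by (auto simp: open_enat_iff)
  then show ?thesis
    using None by (auto simp: slot_def)
qed (use assms in \<open>auto simp: slot_def extend_def\<close>)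

lemma basic_nbhd_subset_open:
  assumes "openin nabla U" "nabla_point x \<in> U"
  shows "\<exists>h. basic_nbhd x h \<subseteq> U"
proof -
  have sub: "U \<subseteq> UNIV // mod_fin" and op: "openin box_topology (\<Union>U)"
    using assms by (auto simp: openin_nabla)
  have "extend x \<in> \<Union>U"
    using assms(2) mem_Union_nabla_open_iff[OF sub] by (simp add: nabla_point_def)
  then obtain B where B: "is_box B" "extend x \<in> B" "B \<subseteq> \<Union>U"
    using op unfolding openin_box_topology arbitrary_union_of_alt by blast
  then obtain V where V: "\<And>n. open (V n)" "B = {z. \<forall>n. z n \<in> V n}"
    unfolding is_box_def by blast
  then have "\<forall>n. \<exists>k. \<forall>h. h n = k \<longrightarrow> slot x h n \<subseteq> V n"
    using B slot_subset_open by blast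
  then obtain h where "\<forall>n. \<forall>h'. h' n = h n \<longrightarrow> slot x h' n \<subseteq> V n"
    by metis
  then have h: "slot x h n \<subseteq> V n" for n
    by blast
  have "basic_nbhd x h \<subseteq> U"
  proof
    fix p assume "p \<in> basic_nbhd x h"
    then obtain z where p: "p = mod_fin `` {z}" and z: "\<forall>\<^sub>\<infinity>n. z n \<in> slot x h n"
      by (auto simp: basic_nbhd_def)
    \<comment> \<open>Resetting z to \<open>extend x\<close> at the finitely many exceptional
      coordinates keeps its class and brings it into the box B.\<close>
    define w where "w = (\<lambda>n. if z n \<in> slot x h n then z n else extend x n)"
    have "w n \<in> V n" for n
      using h[of n] extend_in_slot_self[of x n h] by (auto simp: w_def)
    then have "w \<in> \<Union>U"
      using B V by blast
    then have "mod_fin `` {w} \<in> U"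
      using mem_Union_nabla_open_iff[OF sub] by blast
    moreover have "\<forall>\<^sub>\<infinity>n. z n = w n"
      using z by (rule eventually_mono) (simp add: w_def)
    ultimately show "p \<in> U"
      using p mod_fin_class_eq_iff by metis
  qed
  then show ?thesis
    by (intro exI[of _ h])
qed

lemma basic_nbhd_inter_iff:
  "basic_nbhd x g \<inter> basic_nbhd y h \<noteq> {} \<longleftrightarrow>
     (\<forall>\<^sub>\<infinity>n. n \<in> dom x \<and> n \<in> dom y \<longrightarrow> x n = y n) \<and>
     almost_gt (pdiff x y) h \<and> almost_gt (pdiff y x) g"
  (is "?L \<longleftrightarrow> ?R")
proof
  assume ?L
  then obtain z where "\<forall>\<^sub>\<infinity>n. z n \<in> slot x g n" and "\<forall>\<^sub>\<infinity>n. z n \<in> slot y h n"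
    unfolding basic_nbhd_def[of x]
    by (auto simp: class_in_basic_nbhd_iff)
  then have "\<forall>\<^sub>\<infinity>n. z n \<in> slot x g n \<and> z n \<in> slot y h n"
    by (rule eventually_conj)
  then have "\<forall>\<^sub>\<infinity>n. (n \<in> dom x \<and> n \<in> dom y \<longrightarrow> x n = y n) \<and>
      (n \<in> dom x \<and> x n \<noteq> y n \<longrightarrow> h n < the (x n)) \<and>
      (n \<in> dom y \<and> y n \<noteq> x n \<longrightarrow> g n < the (y n))"
    by (rule eventually_mono) (auto simp: slot_def split: option.splits)
  then show ?R
    by (simp add: almost_gt_pdiff_iff eventually_conj_iff)
next
  assume ?R
  then have "\<forall>\<^sub>\<infinity>n. (n \<in> dom x \<and> n \<in> dom y \<longrightarrow> x n = y n) \<and>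
      (n \<in> dom x \<and> x n \<noteq> y n \<longrightarrow> h n < the (x n)) \<and>
      (n \<in> dom y \<and> y n \<noteq> x n \<longrightarrow> g n < the (y n))"
    by (simp add: almost_gt_pdiff_iff eventually_conj_iff)
  \<comment> \<open>The union of the two functions is a common point: at almost every coordinate of
    the common domain the values agree, on exactly one domain the growth conditions apply, and off
    both the value \<infinity> lies in both slots.\<close>
  then have "\<forall>\<^sub>\<infinity>n. extend (x ++ y) n \<in> slot x g n \<and> extend (x ++ y) n \<in> slot y h n"
  proof (rule eventually_mono)
    fix n
    assume "(n \<in> dom x \<and> n \<in> dom y \<longrightarrow> x n = y n) \<and>
      (n \<in> dom x \<and> x n \<noteq> y n \<longrightarrow> h n < the (x n)) \<and>
      (n \<in> dom y \<and> y n \<noteq> x n \<longrightarrow> g n < the (y n))"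
    then show "extend (x ++ y) n \<in> slot x g n \<and> extend (x ++ y) n \<in> slot y h n"
      by (cases "x n"; cases "y n") (simp_all add: slot_def extend_def map_add_def domIff)
  qed
  then have "nabla_point (x ++ y) \<in> basic_nbhd x g \<inter> basic_nbhd y h"
    by (simp add: nabla_point_def class_in_basic_nbhd_iff eventually_conj_iff)
  then show ?L
    by blast
qed

section \<open>From \<Delta> to monotone normality and on to halvability\<close>

lemma almost_gt_mono:
  assumes "almost_gt x g" "\<And>n. h n \<le> g n"
  shows "almost_gt x h"
proof -
  have "{n \<in> dom x. \<not> the (x n) > h n} \<subseteq> {n \<in> dom x. \<not> the (x n) > g n}"
    using assms(2) by (auto simp: not_less intro: order_trans)
  then show ?thesis
    using assms(1) finite_subset unfolding almost_gt_def by blast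
qed

lemma Delta_imp_monotonically_normal_in:
  assumes "Delta B"
  shows "monotonically_normal_in nabla (nabla_set B)"
proof -
  obtain F :: "(nat \<rightharpoonup> nat) \<Rightarrow> nat \<Rightarrow> nat" where F: "\<And>x y. x \<in> B \<Longrightarrow> y \<in> B \<Longrightarrow> switch x y \<Longrightarrow>
      \<not> almost_gt (pdiff x y) (F y) \<or> \<not> almost_gt (pdiff y x) (F x)"
    using assms unfolding Delta_def by blast
  \<comment> \<open>The operator G acts on classes, whereas F acts on functions, so one
    representative in B is fixed for each point.\<close>
  have "\<forall>p\<in>nabla_set B. \<exists>x. x \<in> B \<and> nabla_point x = p"
    by (auto simp: nabla_set_def)
  then obtain r where r: "\<And>p. p \<in> nabla_set B \<Longrightarrow> r p \<in> B \<and> nabla_point (r p) = p"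
    by metis
  have "\<forall>x U. \<exists>h. openin nabla U \<and> nabla_point x \<in> U \<longrightarrow> basic_nbhd x h \<subseteq> U"
    using basic_nbhd_subset_open by blast
  then obtain H where H: "\<And>x U. openin nabla U \<Longrightarrow> nabla_point x \<in> U \<Longrightarrow> basic_nbhd x (H x U) \<subseteq> U"
    by metis
  \<comment> \<open>The bound \<open>F x\<close> serves to separate switching pairs;
    \<open>H x U\<close> keeps the neighborhood inside U.\<close>
  define K where "K x U n = max (F x n) (H x U n)" for x U n
  have memI: "nabla_point y \<in> U"
    if "openin nabla U" "nabla_point x \<in> U" "\<forall>\<^sub>\<infinity>n. n \<in> dom x \<longrightarrow> x n = y n"
      "almost_gt (pdiff y x) (K x U)" for x y U
  proof -
    have "almost_gt (pdiff y x) (H x U)"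
      using that(4) by (rule almost_gt_mono) (simp add: K_def)
    then have "nabla_point y \<in> basic_nbhd x (H x U)"
      using that(3) by (simp add: nabla_point_in_basic_nbhd_iff)
    then show ?thesis
      using H that by blast
  qed
  have sub: "basic_nbhd x (K x U) \<subseteq> U" if "openin nabla U" "nabla_point x \<in> U" for x U
  proof -
    have "slot x (K x U) n \<subseteq> slot x (H x U) n" for n
      by (auto simp: slot_def K_def split: option.split
          intro: order.strict_trans1[OF enat_ord_simps(1)[THEN iffD2, OF max.cobounded2]])
    then have "basic_nbhd x (K x U) \<subseteq> basic_nbhd x (H x U)"
      unfolding basic_nbhd_def by (intro image_mono) (auto elim!: eventually_mono)
    then show ?thesis
      using H[OF that] by blast
  qed
  have sep: "nabla_point x \<in> V \<or> nabla_point y \<in> U"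
    if x: "x \<in> B" "openin nabla U" "nabla_point x \<in> U"
      and y: "y \<in> B" "openin nabla V" "nabla_point y \<in> V"
      and ne: "basic_nbhd x (K x U) \<inter> basic_nbhd y (K y V) \<noteq> {}" for x y U V
  proof -
    have compat: "\<forall>\<^sub>\<infinity>n. n \<in> dom x \<and> n \<in> dom y \<longrightarrow> x n = y n"
      and gt: "almost_gt (pdiff x y) (K y V)" "almost_gt (pdiff y x) (K x U)"
      using ne by (simp_all add: basic_nbhd_inter_iff)
    have "almost_gt (pdiff x y) (F y)" "almost_gt (pdiff y x) (F x)"
      using gt by (auto elim!: almost_gt_mono simp: K_def)
    then have "\<not> switch x y"
      using F x(1) y(1) by blast
    \<comment> \<open>Being compatible without switching, one of x and y almost extends the other;
      \<open>memI\<close> puts the larger into the open set given for the smaller.\<close>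
    then show ?thesis
      using compat memI[OF x(2,3) _ gt(2)] memI[OF y(2,3) _ gt(1)] by (auto simp: switch_iff)
  qed
  show ?thesis
    unfolding monotonically_normal_in_def
  proof (intro conjI nabla_set_subset exI[of _ "\<lambda>p U. basic_nbhd (r p) (K (r p) U)"] ballI allI impI)
    fix p U assume p: "p \<in> nabla_set B" and U: "openin nabla U \<and> p \<in> U"
    show "openin nabla (basic_nbhd (r p) (K (r p) U))"
      by (rule openin_basic_nbhd)
    show "p \<in> basic_nbhd (r p) (K (r p) U)"
      using nabla_point_in_basic_nbhd_self[of "r p"] r[OF p] by simp
    show "basic_nbhd (r p) (K (r p) U) \<subseteq> U"
      using sub r[OF p] U by simp
  next
    fix p q U V
    assume "p \<in> nabla_set B" "q \<in> nabla_set B"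
      and "openin nabla U \<and> p \<in> U \<and> openin nabla V \<and> q \<in> V \<and>
        basic_nbhd (r p) (K (r p) U) \<inter> basic_nbhd (r q) (K (r q) V) \<noteq> {}"
    then show "p \<in> V \<or> q \<in> U"
      using sep[of "r p" U "r q" V] r by simp
  qed
qed

text \<open>Choose an open U(x) inside T(x) and halve by S(x) = G(x, U(x)). The separation property
  of G is inherited by every subset of Y, so Z may be smaller than Y.\<close>

lemma monotonically_normal_in_imp_halvable_in:
  assumes mn: "monotonically_normal_in X Y" and sub: "Z \<subseteq> Y"
  shows "halvable_in X Z"
  unfolding halvable_in_def
proof (intro conjI allI impI)
  show "Z \<subseteq> topspace X"
    using mn sub unfolding monotonically_normal_in_def by (meson subset_trans)
  obtain G where G1: "\<forall>x\<in>Y. \<forall>U. openin X U \<and> x \<in> U \<longrightarrow>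
        openin X (G x U) \<and> x \<in> G x U \<and> G x U \<subseteq> U"
    and G2: "\<forall>x\<in>Y. \<forall>y\<in>Y. \<forall>U V. openin X U \<and> x \<in> U \<and> openin X V \<and> y \<in> V \<and>
        G x U \<inter> G y V \<noteq> {} \<longrightarrow> x \<in> V \<or> y \<in> U"
    using mn[unfolded monotonically_normal_in_def] by (elim conjE exE) (rule that)
  fix T assume "neighbornet_in X Z T"
  then have "\<forall>x\<in>Z. \<exists>U. openin X U \<and> x \<in> U \<and> U \<subseteq> T x"
    by (simp add: neighbornet_in_def neighborhood_in_def)
  then obtain U where U: "\<And>x. x \<in> Z \<Longrightarrow> openin X (U x) \<and> x \<in> U x \<and> U x \<subseteq> T x"
    by metis
  have G: "openin X (G x (U x)) \<and> x \<in> G x (U x)" if "x \<in> Z" for x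
    using G1 U[OF that] sub that by blast
  then have "neighbornet_in X Z (\<lambda>x. G x (U x))"
    unfolding neighbornet_in_def neighborhood_in_def by (blast dest: openin_subset)
  moreover have "x \<in> T y \<or> y \<in> T x"
    if xy: "x \<in> Z" "y \<in> Z" and ne: "G x (U x) \<inter> G y (U y) \<noteq> {}" for x y
  proof -
    have "x \<in> Y" "y \<in> Y"
      using xy sub by blast+
    then have "x \<in> U y \<or> y \<in> U x"
      using G2[rule_format, of x y "U x" "U y"] U[OF xy(1)] U[OF xy(2)] ne by simp
    then show ?thesis
      using U xy by blast
  qed
  ultimately show "\<exists>S. neighbornet_in X Z S \<and>
      (\<forall>x\<in>Z. \<forall>y\<in>Z. S x \<inter> S y \<noteq> {} \<longrightarrow> x \<in> T y \<or> y \<in> T x)"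
    by (intro exI[of _ "\<lambda>x. G x (U x)"]) blast
qed

section \<open>From halvability back to \<Delta>\<close>

lemma halvable_in_nabla_star_imp_Delta:
  assumes "halvable_in nabla (nabla_star A)"
  shows "Delta A"
proof -
  have "\<forall>p\<in>nabla_star A. \<exists>x. nabla_point x = p"
    by (auto simp: nabla_star_def nabla_set_def)
  then obtain r where r: "\<And>p. p \<in> nabla_star A \<Longrightarrow> nabla_point (r p) = p"
    by metis
  \<comment> \<open>Any bound would do in place of 0: switching already violates the requirement on
    \<open>dom x\<close> alone.\<close>
  define T where "T p = basic_nbhd (r p) (\<lambda>_. 0)" for p
  have "neighbornet_in nabla (nabla_star A) T"
    unfolding neighbornet_in_def neighborhood_in_def T_def
    using openin_basic_nbhd openin_subset nabla_point_in_basic_nbhd_self r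
    by (metis subset_refl)
  then obtain S where S: "neighbornet_in nabla (nabla_star A) S"
    and half: "\<And>p q. p \<in> nabla_star A \<Longrightarrow> q \<in> nabla_star A \<Longrightarrow> S p \<inter> S q \<noteq> {} \<Longrightarrow>
      p \<in> T q \<or> q \<in> T p"
    using assms unfolding halvable_in_def by metis
  have "\<exists>h. basic_nbhd x h \<subseteq> S (nabla_point x)" if "nabla_point x \<in> nabla_star A" for x
    using S that basic_nbhd_subset_open unfolding neighbornet_in_def neighborhood_in_def
    by (meson subset_trans)
  then obtain F where F: "\<And>x. nabla_point x \<in> nabla_star A \<Longrightarrow>
      basic_nbhd x (F x) \<subseteq> S (nabla_point x)"
    by metis
  \<comment> \<open>\<open>T\<close> is built from the chosen representative \<open>y'\<close>,
    which may differ from y. Each of their classes lies in the basic neighborhood of the other, so y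
    is almost contained in \<open>y'\<close>, and membership in \<open>T\<close> would make y almost
    contained in x.\<close>
  have no_T: "nabla_point x \<notin> T (nabla_point y)"
    if "switch x y" "nabla_point y \<in> nabla_star A" for x y
  proof
    define y' where "y' = r (nabla_point y)"
    assume "nabla_point x \<in> T (nabla_point y)"
    then have "\<forall>\<^sub>\<infinity>n. n \<in> dom y' \<longrightarrow> y' n = x n"
      by (simp add: T_def y'_def nabla_point_in_basic_nbhd_iff)
    moreover have "nabla_point y \<in> basic_nbhd y' (\<lambda>_. 0)" "nabla_point y' \<in> basic_nbhd y (\<lambda>_. 0)"
      using nabla_point_in_basic_nbhd_self r[OF that(2)] by (metis y'_def)+
    then have "\<forall>\<^sub>\<infinity>n. n \<in> dom y \<longrightarrow> y n = y' n"
      by (simp add: nabla_point_in_basic_nbhd_iff)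
    ultimately have "\<forall>\<^sub>\<infinity>n. n \<in> dom y \<longrightarrow> y n = x n"
      by eventually_elim (simp add: domIff)
    then show False
      using that by (simp add: switch_iff)
  qed
  have "\<not> almost_gt (pdiff x y) (F y) \<or> \<not> almost_gt (pdiff y x) (F x)"
    if "x \<in> A" "y \<in> A" "switch x y" for x y
  proof -
    have star: "nabla_point x \<in> nabla_star A" "nabla_point y \<in> nabla_star A"
      using that(1,2) switch_inf_coinf[OF that(3)] switch_inf_coinf[OF switch_sym[OF that(3)]]
      by (auto simp: nabla_star_def nabla_set_def)
    then have "S (nabla_point x) \<inter> S (nabla_point y) = {}"
      using half no_T that(3) switch_sym by blast
    then have "basic_nbhd x (F x) \<inter> basic_nbhd y (F y) = {}"
      using F star by blast
    \<comment> \<open>Since x and y almost agree on their common domain, disjointness can only come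
      from the failure of a growth condition.\<close>
    then show ?thesis
      using basic_nbhd_inter_iff[of x "F x" y "F y"] that(3) unfolding switch_iff by blast
  qed
  then show ?thesis
    unfolding Delta_def by blast
qed

section \<open>Adjoining functions that never switch, and closing under almost equality\<close>

lemma Delta_add_nonswitching:
  assumes "Delta A" "C \<inter> inf_coinf = {}"
  shows "Delta (A \<union> C)"
proof -
  obtain F :: "(nat \<rightharpoonup> nat) \<Rightarrow> nat \<Rightarrow> nat" where F: "\<forall>x\<in>A. \<forall>y\<in>A. switch x y \<longrightarrow>
      \<not> almost_gt (pdiff x y) (F y) \<or> \<not> almost_gt (pdiff y x) (F x)"
    using assms(1) unfolding Delta_def by blast
  \<comment> \<open>Both members of a switching pair lie in \<open>inf_coinf\<close>, hence outside
    C, so the same F still works.\<close>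
  have "x \<in> A" "y \<in> A" if "x \<in> A \<union> C" "y \<in> A \<union> C" "switch x y" for x y
    using switch_inf_coinf[OF that(3)] switch_inf_coinf[OF switch_sym[OF that(3)]] that assms(2)
    by blast+
  then show ?thesis
    unfolding Delta_def using F by (intro exI[of _ F]) blast
qed

lemma nabla_point_eq_if_almost_eq:
  assumes "almost_eq x y"
  shows "nabla_point x = nabla_point y"
proof -
  have "\<forall>\<^sub>\<infinity>n. n \<in> dom x \<longrightarrow> x n = y n" "\<forall>\<^sub>\<infinity>n. n \<in> dom y \<longrightarrow> y n = x n"
    using assms by (simp_all add: almost_eq_def finite_graph_diff_iff)
  then have "\<forall>\<^sub>\<infinity>n. extend x n = extend y n"
    by eventually_elim (auto simp: extend_def split: option.split)
  then show ?thesis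
    by (simp add: nabla_point_def mod_fin_class_eq_iff)
qed

text \<open>Almost equal functions extend to the same class, so the closure adds no points and
  \<open>nabla_plus\<close> reduces to adjoining the total functions and the empty function.\<close>

lemma nabla_set_almost_closure: "nabla_set (almost_closure B) = nabla_set B"
proof
  show "nabla_set (almost_closure B) \<subseteq> nabla_set B"
    using nabla_point_eq_if_almost_eq by (auto simp: nabla_set_def almost_closure_def)
  have "B \<subseteq> almost_closure B"
    unfolding almost_closure_def almost_eq_def by (auto intro!: bexI)
  then show "nabla_set B \<subseteq> nabla_set (almost_closure B)"
    by (auto simp: nabla_set_def)
qed

theorem theorem19:
  fixes A :: "(nat \<rightharpoonup> nat) set"
  shows "(Delta A \<longleftrightarrow> halvable_in nabla (nabla_star A)) \<and>
         (halvable_in nabla (nabla_star A) \<longleftrightarrow> monotonically_normal_in nabla (nabla_plus A))"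
proof -
  have plus: "nabla_plus A = nabla_set (A \<union> (total_funs \<union> {Map.empty}))"
    by (simp add: nabla_plus_def nabla_set_almost_closure Un_assoc)
  have "(total_funs \<union> {Map.empty}) \<inter> inf_coinf = {}"
    by (auto simp: total_funs_def inf_coinf_def)
  then have "Delta A \<Longrightarrow> monotonically_normal_in nabla (nabla_plus A)"
    unfolding plus by (intro Delta_imp_monotonically_normal_in Delta_add_nonswitching)
  moreover have "nabla_star A \<subseteq> nabla_plus A"
    unfolding plus by (auto simp: nabla_star_def nabla_set_def)
  then have "monotonically_normal_in nabla (nabla_plus A) \<Longrightarrow> halvable_in nabla (nabla_star A)"
    by (rule monotonically_normal_in_imp_halvable_in[rotated])
  ultimately show ?thesis
    using halvable_in_nabla_star_imp_Delta by blast
qed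

end
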